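(* Let $0<M<1$ and $\theta\in[0,\pi]$ be fixed. Let $\omega^h>0$ and let $\omega=\omega(\omega^h,h,M,\theta)$ be given by the dispersion relation of one of the three schemes RT1-NC, RT2-NC, P1-C (formulas in the context), where $\omega$ and $\omega^h$ are the continuous and numerical angular frequencies, respectively. Define the dispersion error as $|\omega^h-\omega|$. Then, as $\omega h\to 0$, $$|\omega^h-\omega|=A_1(M,\theta)\,\omega^3h^2+O(\omega^5h^4),$$ where the leading coefficient function $A_1=A_1(M,\theta)$ is: for the RT1-NC method, $$A_1=\frac{\left|2(1+\cos(4\theta))+4M(\cos(3\theta)-3\cos\theta)+M^2(\cos(4\theta)-6\cos(2\theta)-7)\right|}{384(1+M\cos\theta)^3};$$ for the RT2-NC method, $$A_1=\frac{\left|2(1+\cos(4\theta))+4M(\cos(3\theta)-\cos\theta)+M^2(\cos(4\theta)-2\cos(2\theta)-3)\right|}{192(1+M\cos\theta)^3};$$ for the P1-C method, $$A_1=\frac{\left|3+\cos(4\theta)-4M^2\cos^4\theta\right|}{96(1+M\cos\theta)^3}.$$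
   Context: Background. The convected Helmholtz equation on a domain $\Omega\subset\mathbb{R}^2$ is $-\mathrm{div}(A\nabla p)-2i\omega\,\mathbf{M}\cdot\nabla p-\omega^2p=0$, where $M$ is the Mach number, $\mathbf{M}=(M,0)$ and $A=\mathrm{diag}(1-M^2,1)$. For a plane wave with wave vector $\mathbf{k}=(k_1,k_2)=k(\cos\theta,\sin\theta)$, $k=|\mathbf{k}|$, its continuous dispersion relation is $\omega=k_1M+|\mathbf{k}|=k(1+M\cos\theta)$. Numerical dispersion relations. The equation is discretized on a uniform mesh of squares of side $h>0$ by one of three lowest-order quadrilateral finite element methods: RT1-NC (Rannacher–Turek nonconforming element with edge-midpoint degrees of freedom), RT2-NC (Rannacher–Turek nonconforming element with edge-mean degrees of freedom), and P1-C (conforming element). Let the numerical plane wave be $p^h=\exp\{i(k_1^hx+k_2^hy)\}$ with numerical wave vector $(k_1^h,k_2^h)=k^h(\cos\theta,\sin\theta)$, and let the numerical angular frequency be $\omega^h=k^h(1+M\cos\theta)$, i.e. $k^h=\omega^h/(1+M\cos\theta)$. For $j=1,2$ put $$C_j=\cos(k_j^hh/2),\quad S_j=\sin(k_j^hh/2),\quad \widetilde C_j=\cos(k_j^hh),\quad \widetilde S_j=\sin(k_j^hh).$$ The dispersion relations, expressing $\omega$ in terms of $\omega^h,h,M,\theta$ for small $\omega^hh$, are as follows. RT1-NC: $$\omega=\frac{4M}{h}\left(G_1+\sqrt{G_1^2+\frac32\,\frac{(C_1+C_2)(1-C_1C_2)-M^2S_1^2C_2}{M^2(C_1+C_2)(2+C_1C_2)}}\right),\qquad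 G_1=\frac{S_1C_2(2C_1+C_2)}{(C_1+C_2)(C_1C_2+2)}.$$ RT2-NC: $$\omega=\frac{6M}{h}\left(G_2+\sqrt{G_2^2+\frac23\,\frac{k_1^h\widetilde S_2(1-\widetilde C_1)+k_2^h\widetilde S_1(1-\widetilde C_2)-M^2k_1^h\widetilde S_2(1-\widetilde C_1)}{M^2\left(k_1^h\widetilde S_2(5+\widetilde C_1)+k_2^h\widetilde S_1(5+\widetilde C_2)\right)}}\right),$$ $$G_2=\frac{k_1^h\widetilde S_1\widetilde S_2+k_2^h(1-\widetilde C_1)(1+\widetilde C_2)}{k_1^h\widetilde S_2(5+\widetilde C_1)+k_2^h\widetilde S_1(5+\widetilde C_2)},$$ where, if $k_1^h=0$ or $k_2^h=0$, the quotients of the form $0/0$ are understood as their limits (continuous extension in $\theta$). P1-C: $$\omega=\frac{3M}{h}\left(G_3+\sqrt{G_3^2-\frac23\,\frac{2\widetilde C_1\widetilde C_2+\widetilde C_1+\widetilde C_2-4+M^2(2-\widetilde C_1\widetilde C_2-2\widetilde C_1+\widetilde C_2)}{M^2\left(\widetilde C_1\widetilde C_2+2(\widetilde C_1+\widetilde C_2)+4\right)}}\right),$$ $$G_3=\frac{\widetilde S_1(2+\widetilde C_2)}{\widetilde C_1\widetilde C_2+2(\widetilde C_1+\widetilde C_2)+4}.$$ The constant implied in $O(\omega^5h^4)$ may depend on $M$ and $\theta$. *)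

theory Defs
  imports "HOL-Analysis.Analysis" "HOL-Library.Landau_Symbols"
begin

datatype scheme = RT1_NC | RT2_NC | P1_C

text \<open>
  Throughout, \<open>M\<close> is the Mach number, \<open>\<theta>\<close> the propagation angle, \<open>w\<close> the numerical angular
  frequency and \<open>h\<close> the mesh size. The numerical wave number is \<open>w / (1 + M cos \<theta>)\<close>.
\<close>

definition kh :: "real \<Rightarrow> real \<Rightarrow> real \<Rightarrow> real" where
  "kh M \<theta> w = w / (1 + M * cos \<theta>)"

definition k1h :: "real \<Rightarrow> real \<Rightarrow> real \<Rightarrow> real" where
  "k1h M \<theta> w = kh M \<theta> w * cos \<theta>"

definition k2h :: "real \<Rightarrow> real \<Rightarrow> real \<Rightarrow> real" where
  "k2h M \<theta> w = kh M \<theta> w * sin \<theta>"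

definition omega_RT1 :: "real \<Rightarrow> real \<Rightarrow> real \<Rightarrow> real \<Rightarrow> real" where
  "omega_RT1 M \<theta> w h =
    (let C1 = cos (k1h M \<theta> w * h / 2); C2 = cos (k2h M \<theta> w * h / 2);
         S1 = sin (k1h M \<theta> w * h / 2);
         G1 = S1 * C2 * (2 * C1 + C2) / ((C1 + C2) * (C1 * C2 + 2))
     in 4 * M / h * (G1 + sqrt (G1\<^sup>2 + 3 / 2 *
          (((C1 + C2) * (1 - C1 * C2) - M\<^sup>2 * S1\<^sup>2 * C2)
            / (M\<^sup>2 * (C1 + C2) * (2 + C1 * C2))))))"

text \<open>
  The two quotients in the relation for \<open>RT2_NC\<close> have the form 0/0 when a component of the
  wave vector vanishes. There they stand for their limits in \<open>\<theta>\<close> (with \<open>w\<close> and \<open>h\<close> fixed and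
  the wave vector varying with \<open>\<theta>\<close>), which \<open>RT2_ext\<close> takes; division by zero in HOL would
  give 0 instead.
\<close>

definition RT2_G_quotient :: "real \<Rightarrow> real \<Rightarrow> real \<Rightarrow> real \<Rightarrow> real" where
  "RT2_G_quotient M w h \<theta> =
    (let k1 = k1h M \<theta> w; k2 = k2h M \<theta> w;
         C1 = cos (k1 * h); C2 = cos (k2 * h);
         S1 = sin (k1 * h); S2 = sin (k2 * h)
     in (k1 * S1 * S2 + k2 * (1 - C1) * (1 + C2))
          / (k1 * S2 * (5 + C1) + k2 * S1 * (5 + C2)))"

definition RT2_root_quotient :: "real \<Rightarrow> real \<Rightarrow> real \<Rightarrow> real \<Rightarrow> real" where
  "RT2_root_quotient M w h \<theta> =
    (let k1 = k1h M \<theta> w; k2 = k2h M \<theta> w;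
         C1 = cos (k1 * h); C2 = cos (k2 * h);
         S1 = sin (k1 * h); S2 = sin (k2 * h)
     in (k1 * S2 * (1 - C1) + k2 * S1 * (1 - C2) - M\<^sup>2 * k1 * S2 * (1 - C1))
          / (M\<^sup>2 * (k1 * S2 * (5 + C1) + k2 * S1 * (5 + C2))))"

definition RT2_ext :: "(real \<Rightarrow> real \<Rightarrow> real \<Rightarrow> real \<Rightarrow> real) \<Rightarrow> real \<Rightarrow> real \<Rightarrow> real \<Rightarrow> real \<Rightarrow> real" where
  "RT2_ext q M w h \<theta> =
    (if k1h M \<theta> w = 0 \<or> k2h M \<theta> w = 0
     then Lim (at \<theta> within {0..pi}) (q M w h)
     else q M w h \<theta>)"

definition omega_RT2 :: "real \<Rightarrow> real \<Rightarrow> real \<Rightarrow> real \<Rightarrow> real" where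
  "omega_RT2 M \<theta> w h =
    (let G2 = RT2_ext RT2_G_quotient M w h \<theta>
     in 6 * M / h * (G2 + sqrt (G2\<^sup>2 + 2 / 3 * RT2_ext RT2_root_quotient M w h \<theta>)))"

definition omega_P1 :: "real \<Rightarrow> real \<Rightarrow> real \<Rightarrow> real \<Rightarrow> real" where
  "omega_P1 M \<theta> w h =
    (let C1 = cos (k1h M \<theta> w * h); C2 = cos (k2h M \<theta> w * h);
         S1 = sin (k1h M \<theta> w * h);
         G3 = S1 * (2 + C2) / (C1 * C2 + 2 * (C1 + C2) + 4)
     in 3 * M / h * (G3 + sqrt (G3\<^sup>2 - 2 / 3 *
          ((2 * C1 * C2 + C1 + C2 - 4 + M\<^sup>2 * (2 - C1 * C2 - 2 * C1 + C2))
            / (M\<^sup>2 * (C1 * C2 + 2 * (C1 + C2) + 4))))))"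

fun omega :: "scheme \<Rightarrow> real \<Rightarrow> real \<Rightarrow> real \<Rightarrow> real \<Rightarrow> real" where
  "omega RT1_NC = omega_RT1"
| "omega RT2_NC = omega_RT2"
| "omega P1_C = omega_P1"

fun A1 :: "scheme \<Rightarrow> real \<Rightarrow> real \<Rightarrow> real" where
  "A1 RT1_NC M \<theta> =
    \<bar>2 * (1 + cos (4 * \<theta>)) + 4 * M * (cos (3 * \<theta>) - 3 * cos \<theta>)
      + M\<^sup>2 * (cos (4 * \<theta>) - 6 * cos (2 * \<theta>) - 7)\<bar> / (384 * (1 + M * cos \<theta>) ^ 3)"
| "A1 RT2_NC M \<theta> =
    \<bar>2 * (1 + cos (4 * \<theta>)) + 4 * M * (cos (3 * \<theta>) - cos \<theta>)
      + M\<^sup>2 * (cos (4 * \<theta>) - 2 * cos (2 * \<theta>) - 3)\<bar> / (192 * (1 + M * cos \<theta>) ^ 3)"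
| "A1 P1_C M \<theta> =
    \<bar>3 + cos (4 * \<theta>) - 4 * M\<^sup>2 * cos \<theta> ^ 4\<bar> / (96 * (1 + M * cos \<theta>) ^ 3)"

definition dispersion_error :: "scheme \<Rightarrow> real \<Rightarrow> real \<Rightarrow> real \<Rightarrow> real \<Rightarrow> real" where
  "dispersion_error s M \<theta> w h = \<bar>w - omega s M \<theta> w h\<bar>"

text \<open>
  The asymptotic regime on pairs \<open>(w, h)\<close>: both are positive and the product \<open>w h\<close> tends
  to 0, while neither factor is required to do so on its own. The dispersion relations are
  meaningful only for small \<open>w h\<close>, and \<open>omega s M \<theta> w h * h\<close> is a function of \<open>w h\<close> that
  tends to 0 with it, so this is the regime in which the angular frequency times the mesh
  size tends to 0.
\<close>

definition small_wh :: "(real \<times> real) filter" where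
  "small_wh = inf (filtercomap (\<lambda>(w, h). w * h) (at_right 0)) (principal {(w, h). w > 0 \<and> h > 0})"

end

theory Submission
  imports Defs "HOL-Real_Asymp.Real_Asymp"
begin
text \<open>
  Put \<open>t = w h\<close>. Each dispersion relation reads \<open>\<omega> = w \<phi>(t)\<close> with
  \<open>\<phi>(t) = K (G(t) + sqrt (G(t)\<^sup>2 + Q(t)))\<close>, where \<open>G\<close> and \<open>Q\<close> are even functions of \<open>t\<close>,
  namely rational expressions in \<open>cos (a t)\<close>, \<open>cos (b t)\<close>, \<open>sin (a t) / t\<close> and
  \<open>(1 - cos (a t)) / t\<^sup>2\<close>. Hence \<open>\<phi>(t) = 1 + c t\<^sup>2 + O(t\<^sup>4)\<close>, and computing \<open>c\<close> from the
  second-order expansions of \<open>G\<close> and \<open>Q\<close> gives \<open>\<bar>c\<bar> = A1\<close>. Since \<open>\<omega> / w\<close> tends to 1,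
  \<open>w\<^sup>3\<close> and \<open>w\<^sup>5\<close> may be replaced by \<open>\<omega>\<^sup>3\<close> and \<open>\<omega>\<^sup>5\<close>.
\<close>

section \<open>Second-order expansions of even functions\<close>

text \<open>Only even functions of \<open>t\<close> are expanded, so the term after
  \<open>b * t^2\<close> has order \<open>t^4\<close>. The filter is one-sided because
  \<open>t = w * h\<close> is positive. Keeping the expansion as a Landau bound avoids derivatives:
  arithmetic on jets becomes bookkeeping of remainders.\<close>

definition jet :: "(real \<Rightarrow> real) \<Rightarrow> real \<Rightarrow> real \<Rightarrow> bool" where
  "jet f a b \<longleftrightarrow> (\<lambda>t. f t - (a + b * t\<^sup>2)) \<in> O[at_right 0](\<lambda>t. t ^ 4)"

lemma jet_cong:
  assumes "jet f a b" and "\<And>t. t > 0 \<Longrightarrow> f t = g t" and "a = a'" and "b = b'"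
  shows "jet g a' b'"
proof -
  have "\<forall>\<^sub>F t in at_right 0. f t - (a + b * t\<^sup>2) = g t - (a + b * t\<^sup>2)"
    using eventually_at_right_less[of "0::real"] by eventually_elim (simp add: assms(2))
  from landau_o.big.in_cong[OF this] show ?thesis
    using assms(1,3,4) unfolding jet_def by blast
qed

lemma jet_eq: "jet f a b \<Longrightarrow> a = a' \<Longrightarrow> b = b' \<Longrightarrow> jet f a' b'"
  by simp

lemma jet_tendsto:
  assumes "jet f a b"
  shows "(f \<longlongrightarrow> a) (at_right 0)"
proof -
  have "(\<lambda>t::real. t ^ 4) \<in> o[at_right 0](\<lambda>_. 1)"
    by real_asymp
  with assms have "(\<lambda>t. f t - (a + b * t\<^sup>2)) \<in> o[at_right 0](\<lambda>_. 1)"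
    unfolding jet_def by (rule landau_o.big_small_trans)
  then have 1: "((\<lambda>t. f t - (a + b * t\<^sup>2)) \<longlongrightarrow> 0) (at_right 0)"
    by (auto dest: smalloD_tendsto)
  have "((\<lambda>t. (f t - (a + b * t\<^sup>2)) + (a + b * t\<^sup>2)) \<longlongrightarrow> 0 + (a + b * 0\<^sup>2)) (at_right 0)"
    by (intro tendsto_intros 1)
  then show ?thesis by simp
qed

lemma jet_bounded:
  assumes "jet f a b"
  shows "f \<in> O[at_right 0](\<lambda>_. 1)"
proof -
  have "((\<lambda>t. f t / 1) \<longlongrightarrow> a) (at_right 0)"
    using jet_tendsto[OF assms] by simp
  then show ?thesis by (rule bigoI_tendsto) auto
qed

lemma jet_const: "jet (\<lambda>_. a) a 0"
  by (simp add: jet_def)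

lemma jet_linear: "jet (\<lambda>t. a + b * t\<^sup>2) a b"
  by (simp add: jet_def)

lemma jet_square: "jet (\<lambda>t. t\<^sup>2) 0 1"
  by (simp add: jet_def)

lemma jet_add:
  assumes "jet f a b" and "jet g c d"
  shows "jet (\<lambda>t. f t + g t) (a + c) (b + d)"
  using sum_in_bigo(1)[OF assms[unfolded jet_def]] by (simp add: jet_def algebra_simps)

lemma jet_diff:
  assumes "jet f a b" and "jet g c d"
  shows "jet (\<lambda>t. f t - g t) (a - c) (b - d)"
  using sum_in_bigo(2)[OF assms[unfolded jet_def]] by (simp add: jet_def algebra_simps)

text \<open>Each remainder is multiplied by a bounded factor and stays O(t^4). The cross term
  \<open>b * d * t^4\<close>, dropped from the product of the two polynomials, has the same
  order.\<close>

lemma jet_mult: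
  assumes f: "jet f a b" and g: "jet g c d"
  shows "jet (\<lambda>t. f t * g t) (a * c) (a * d + b * c)"
proof -
  have 1: "(\<lambda>t. (f t - (a + b * t\<^sup>2)) * g t) \<in> O[at_right 0](\<lambda>t. t ^ 4)"
    using landau_o.big.mult[OF f[unfolded jet_def] jet_bounded[OF g]] by simp
  have 2: "(\<lambda>t. (a + b * t\<^sup>2) * (g t - (c + d * t\<^sup>2))) \<in> O[at_right 0](\<lambda>t. t ^ 4)"
    using landau_o.big.mult[OF jet_bounded[OF jet_linear] g[unfolded jet_def]] by simp
  have 3: "(\<lambda>t. b * d * t ^ 4) \<in> O[at_right 0](\<lambda>t. t ^ 4)"
    by simp
  have "f t * g t - (a * c + (a * d + b * c) * t\<^sup>2) =
      (f t - (a + b * t\<^sup>2)) * g t + (a + b * t\<^sup>2) * (g t - (c + d * t\<^sup>2)) + b * d * t ^ 4" for t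
    by algebra
  then show ?thesis
    unfolding jet_def using sum_in_bigo(1)[OF sum_in_bigo(1)[OF 1 2] 3] by presburger
qed

lemma jet_cmult:
  assumes "jet f a b"
  shows "jet (\<lambda>t. k * f t) (k * a) (k * b)"
  using jet_mult[OF jet_const assms] by simp

text \<open>Both division and square root are reduced to this: their error is a numerator of order
  \<open>t^4\<close> over a denominator that stays away from 0.\<close>

lemma jet_quotient_remainder:
  assumes f: "jet f 0 0" and g: "(g \<longlongrightarrow> d) (at_right 0)" and "d \<noteq> 0"
  shows "(\<lambda>t. f t / g t) \<in> O[at_right 0](\<lambda>t. t ^ 4)"
proof -
  have "((\<lambda>t. inverse (g t) / 1) \<longlongrightarrow> inverse d) (at_right 0)"
    using tendsto_inverse[OF g \<open>d \<noteq> 0\<close>] by simp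
  then have "(\<lambda>t. inverse (g t)) \<in> O[at_right 0](\<lambda>_. 1)"
    by (rule bigoI_tendsto) auto
  from landau_o.big.mult[OF f[unfolded jet_def] this] show ?thesis
    by (simp add: divide_inverse)
qed

text \<open>By the two equations for \<open>p\<close> and \<open>q\<close>, \<open>f\<close> and
  \<open>(p + q t^2) g\<close> have the same jet, and dividing their difference by \<open>g\<close>
  gives the error of the quotient. Stating the coefficients through equations leaves only polynomial
  identities to check in each application.\<close>

lemma jet_divide:
  assumes f: "jet f a b" and g: "jet g c d" and "c \<noteq> 0" and "a = p * c" and "b = p * d + q * c"
  shows "jet (\<lambda>t. f t / g t) p q"
proof -
  have "jet (\<lambda>t. f t - (p + q * t\<^sup>2) * g t) 0 0"
    by (rule jet_cong[OF jet_diff[OF f jet_mult[OF jet_linear g]]]) (auto simp: assms(4,5))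
  from jet_quotient_remainder[OF this jet_tendsto[OF g] \<open>c \<noteq> 0\<close>]
  have rem: "(\<lambda>t. (f t - (p + q * t\<^sup>2) * g t) / g t) \<in> O[at_right 0](\<lambda>t. t ^ 4)" by simp
  have "\<forall>\<^sub>F t in at_right 0. g t \<noteq> 0"
    using tendsto_imp_eventually_ne[OF jet_tendsto[OF g] \<open>c \<noteq> 0\<close>] .
  then have ev: "\<forall>\<^sub>F t in at_right 0. (f t - (p + q * t\<^sup>2) * g t) / g t = f t / g t - (p + q * t\<^sup>2)"
    by eventually_elim (simp add: field_simps)
  show ?thesis
    using rem unfolding jet_def landau_o.big.in_cong[OF ev] by blast
qed

text \<open>With \<open>s = r + q t^2\<close>, the error is
  \<open>sqrt f - s = (f - s^2) / (sqrt f + s)\<close>. The numerator has zero jet and the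
  denominator tends to \<open>2 * r > 0\<close>.\<close>

lemma jet_sqrt:
  assumes f: "jet f (r\<^sup>2) (2 * r * q)" and "r > 0"
  shows "jet (\<lambda>t. sqrt (f t)) r q"
proof -
  have diff: "jet (\<lambda>t. f t - (r + q * t\<^sup>2) * (r + q * t\<^sup>2)) 0 0"
    by (rule jet_cong[OF jet_diff[OF f jet_mult[OF jet_linear jet_linear]]])
      (auto simp: power2_eq_square)
  have lim: "((\<lambda>t. sqrt (f t) + (r + q * t\<^sup>2)) \<longlongrightarrow> r + r) (at_right 0)"
  proof (intro tendsto_add jet_tendsto[OF jet_linear])
    show "((\<lambda>t. sqrt (f t)) \<longlongrightarrow> r) (at_right 0)"
      using tendsto_real_sqrt[OF jet_tendsto[OF f]] \<open>r > 0\<close> by simp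
  qed
  have rem: "(\<lambda>t. (f t - (r + q * t\<^sup>2) * (r + q * t\<^sup>2)) / (sqrt (f t) + (r + q * t\<^sup>2)))
      \<in> O[at_right 0](\<lambda>t. t ^ 4)"
    by (rule jet_quotient_remainder[OF diff lim]) (use \<open>r > 0\<close> in simp)
  have "\<forall>\<^sub>F t in at_right 0. sqrt (f t) + (r + q * t\<^sup>2) > 0"
    using order_tendstoD(1)[OF lim, of 0] \<open>r > 0\<close> by simp
  moreover have "\<forall>\<^sub>F t in at_right 0. f t > 0"
    using order_tendstoD(1)[OF jet_tendsto[OF f], of 0] \<open>r > 0\<close> by simp
  ultimately have ev: "\<forall>\<^sub>F t in at_right 0.
      (f t - (r + q * t\<^sup>2) * (r + q * t\<^sup>2)) / (sqrt (f t) + (r + q * t\<^sup>2)) =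
        sqrt (f t) - (r + q * t\<^sup>2)"
  proof (eventually_elim)
    case (elim t)
    then have "f t - (r + q * t\<^sup>2) * (r + q * t\<^sup>2) =
        sqrt (f t) * sqrt (f t) - (r + q * t\<^sup>2) * (r + q * t\<^sup>2)"
      by simp
    also have "\<dots> = (sqrt (f t) - (r + q * t\<^sup>2)) * (sqrt (f t) + (r + q * t\<^sup>2))"
      by algebra
    finally have "f t - (r + q * t\<^sup>2) * (r + q * t\<^sup>2) =
        (sqrt (f t) - (r + q * t\<^sup>2)) * (sqrt (f t) + (r + q * t\<^sup>2))" .
    with elim show ?case by (simp add: nonzero_divide_eq_eq)
  qed
  show ?thesis
    using rem unfolding jet_def landau_o.big.in_cong[OF ev] by blast
qed

section \<open>Expansions of the trigonometric building blocks\<close>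

text \<open>The value 1 at 0 makes \<open>sin x = x * sinc x\<close> hold without exception, so
  angles at which a wave vector component vanishes need no separate expansion.\<close>

definition sinc :: "real \<Rightarrow> real" where
  "sinc x = (if x = 0 then 1 else sin x / x)"

lemma sin_eq_sinc: "sin x = x * sinc x"
  by (simp add: sinc_def)

text \<open>This is the continuous extension of (1 - cos x) / x^2, written by the half-angle formula
  so that its properties follow from those of \<open>sinc\<close>.\<close>

definition versinc :: "real \<Rightarrow> real" where
  "versinc x = (sinc (x / 2))\<^sup>2 / 2"

lemma one_minus_cos_eq_versinc: "1 - cos x = x\<^sup>2 * versinc x"
proof -
  have "1 - cos x = 2 * (sin (x / 2))\<^sup>2"
    using cos_double_sin[of "x / 2"] by simp
  then show ?thesis by (simp add: sin_eq_sinc versinc_def power_mult_distrib power_divide)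
qed

lemma sinc_0 [simp]: "sinc 0 = 1"
  by (simp add: sinc_def)

lemma sinc_minus [simp]: "sinc (- x) = sinc x"
  by (simp add: sinc_def)

text \<open>Used for continuity in the angle, which identifies the limits in the RT2-NC
  relation.\<close>

lemma isCont_sinc: "isCont sinc x"
proof (cases "x = 0")
  case True
  have "((\<lambda>x::real. sin x / x) \<longlongrightarrow> 1) (at 0)"
    by real_asymp
  then have "(sinc \<longlongrightarrow> 1) (at 0)"
    by (rule Lim_transform_eventually) (auto simp: eventually_at_filter sinc_def)
  with True show ?thesis by (simp add: isCont_def)
next
  case False
  have "isCont (\<lambda>x. sin x / x) x"
    using False by (intro continuous_intros) auto
  moreover have "\<forall>\<^sub>F y in nhds x. sinc y = sin y / y"
    using t1_space_nhds[OF False] by eventually_elim (simp add: sinc_def)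
  ultimately show ?thesis
    using isCont_cong[of sinc "\<lambda>x. sin x / x" x] by blast
qed

text \<open>The expansion of sin t / t is rescaled by a positive factor, which preserves the
  one-sided filter; negative factors reduce to positive ones because \<open>sinc\<close> is
  even.\<close>

lemma jet_sinc: "jet (\<lambda>t. sinc (a * t)) 1 (- a\<^sup>2 / 6)"
proof -
  have pos: "jet (\<lambda>t. sinc (c * t)) 1 (- c\<^sup>2 / 6)" if "c > 0" for c
  proof -
    have "(\<lambda>t::real. sin t / t - (1 + - 1 / 6 * t\<^sup>2)) \<in> O[at_right 0](\<lambda>t. t ^ 4)"
      by real_asymp
    moreover have "filterlim (\<lambda>t. c * t) (at_right 0) (at_right 0)"
      using that by real_asymp
    ultimately have "jet (\<lambda>t. sin (c * t) / (c * t)) 1 (- c\<^sup>2 / 6)"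
      using landau_o.big.compose that by (fastforce simp: jet_def power_mult_distrib)
    then show ?thesis by (rule jet_cong) (use that in \<open>auto simp: sinc_def\<close>)
  qed
  consider "a > 0" | "a = 0" | "- a > 0" by linarith
  then show ?thesis
  proof cases
    case 3
    from pos[OF this] show ?thesis by simp
  qed (use pos jet_const in auto)
qed

lemma jet_versinc: "jet (\<lambda>t. versinc (a * t)) (1 / 2) (- a\<^sup>2 / 24)"
  unfolding versinc_def
  by (rule jet_cong[OF jet_cmult[OF jet_mult[OF jet_sinc[of "a / 2"] jet_sinc[of "a / 2"]], of "1 / 2"]])
    (auto simp: power2_eq_square)

lemma jet_cos: "jet (\<lambda>t. cos (a * t)) 1 (- a\<^sup>2 / 2)"
proof -
  show ?thesis
    by (rule jet_cong[OF jet_diff[OF jet_const[of 1]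
            jet_mult[OF jet_cmult[OF jet_square, of "a\<^sup>2"] jet_versinc[of a]]]])
      (use one_minus_cos_eq_versinc[of "a * t" for t] in \<open>auto simp: power_mult_distrib field_simps\<close>)
qed

text \<open>
  The square root is \<open>r\<close> to leading order, so the expansion of \<open>G + sqrt (G\<^sup>2 + Q)\<close> is checked
  by squaring and no nested radicals appear.
\<close>

lemma jet_quadratic_root:
  assumes G: "jet G g0 g1" and Q: "jet Q q0 q1" and "K > 0" and "r > 0"
    and "g0 + r = 1 / K" and "g0\<^sup>2 + q0 = r\<^sup>2"
    and "2 * g0 * g1 + q1 = 2 * r * (c / K - g1)"
  shows "jet (\<lambda>t. K * (G t + sqrt ((G t)\<^sup>2 + Q t))) 1 c"
proof -
  \<comment> \<open>The root must have second coefficient \<open>c / K - g1\<close>, since then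
    \<open>K * (g1 + (c / K - g1)) = c\<close>.\<close>
  have "jet (\<lambda>t. (G t)\<^sup>2 + Q t) (r\<^sup>2) (2 * r * (c / K - g1))"
    by (rule jet_cong[OF jet_add[OF jet_mult[OF G G] Q]])
      (use assms(6,7) in \<open>auto simp: power2_eq_square algebra_simps\<close>)
  from jet_cmult[OF jet_add[OF G jet_sqrt[OF this \<open>r > 0\<close>]], of K] show ?thesis
    by (rule jet_cong) (use \<open>K > 0\<close> assms(5) in auto)
qed

section \<open>From the expansion to the dispersion error\<close>

text \<open>\<open>small_wh\<close> is pulled back along the product \<open>w * h\<close>, so a
  statement about small \<open>t\<close> transfers uniformly in the individual factors.\<close>

lemma eventually_small_wh:
  assumes "\<forall>\<^sub>F t in at_right 0. P t"
    and "\<And>w h. w > 0 \<Longrightarrow> h > 0 \<Longrightarrow> P (w * h) \<Longrightarrow> Q (w, h)"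
  shows "\<forall>\<^sub>F x in small_wh. Q x"
  unfolding small_wh_def eventually_inf_principal eventually_filtercomap
  using assms by (intro exI[of _ P]) auto

text \<open>The powers of \<open>om\<close> on both sides equal powers of \<open>w\<close> times
  powers of \<open>\<phi> t\<close>. After a factor \<open>w\<close> is taken out, everything
  depends on \<open>t\<close> alone.\<close>

lemma dispersion_from_jet:
  fixes om :: "real \<Rightarrow> real \<Rightarrow> real"
  assumes \<phi>: "jet \<phi> 1 c"
    and om: "\<forall>\<^sub>F t in at_right 0. \<forall>w > 0. \<forall>h > 0. w * h = t \<longrightarrow> om w h = w * \<phi> t"
  shows "(\<lambda>(w, h). \<bar>w - om w h\<bar> - \<bar>c\<bar> * om w h ^ 3 * h\<^sup>2)
    \<in> O[small_wh](\<lambda>(w, h). om w h ^ 5 * h ^ 4)"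
proof -
  \<comment> \<open>This is \<open>om^3 * h^2 / w\<close> up to the factor |c|. As
    \<open>\<phi>\<close> tends to 1, replacing \<open>w\<close> by \<open>om\<close> in the leading
    term costs only O(t^4), bounded by \<open>B2\<close>.\<close>
  have "jet (\<lambda>t. \<bar>c\<bar> * (t\<^sup>2 * (\<phi> t * (\<phi> t * \<phi> t)))) 0 \<bar>c\<bar>"
    by (rule jet_cong[OF jet_cmult[OF jet_mult[OF jet_square jet_mult[OF \<phi> jet_mult[OF \<phi> \<phi>]]], of "\<bar>c\<bar>"]]) auto
  then obtain B2 where B2:
    "\<forall>\<^sub>F t in at_right 0. \<bar>\<bar>c\<bar> * (t\<^sup>2 * (\<phi> t * (\<phi> t * \<phi> t))) - \<bar>c\<bar> * t\<^sup>2\<bar> \<le> B2 * t ^ 4"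
    unfolding jet_def by (elim landau_o.bigE) (auto simp: algebra_simps)
  from \<phi> obtain B1 where B1: "\<forall>\<^sub>F t in at_right 0. \<bar>\<phi> t - (1 + c * t\<^sup>2)\<bar> \<le> B1 * t ^ 4"
    unfolding jet_def by (elim landau_o.bigE) auto
  have half: "\<forall>\<^sub>F t in at_right 0. \<phi> t > 1 / 2"
    using jet_tendsto[OF \<phi>] by (intro order_tendstoD(1)) auto
  \<comment> \<open>The constant 32 is 2^5: from \<open>\<phi> t > 1 / 2\<close> one gets
    \<open>1 \<le> 32 * \<phi> t ^ 5\<close>, which turns a bound by \<open>w^5 * h^4\<close> into
    one by \<open>om^5 * h^4\<close>.\<close>
  have "\<forall>\<^sub>F x in small_wh. norm (case x of (w, h) \<Rightarrow> \<bar>w - om w h\<bar> - \<bar>c\<bar> * om w h ^ 3 * h\<^sup>2)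
      \<le> (32 * \<bar>B1 + B2\<bar>) * norm (case x of (w, h) \<Rightarrow> om w h ^ 5 * h ^ 4)"
  proof (rule eventually_small_wh[OF eventually_conj[OF om eventually_conj[OF B1 eventually_conj[OF B2 half]]]])
    fix w h :: real
    define t where "t = w * h"
    assume "w > 0" "h > 0" and
      "(\<forall>w' > 0. \<forall>h' > 0. w' * h' = w * h \<longrightarrow> om w' h' = w' * \<phi> (w * h)) \<and>
      \<bar>\<phi> (w * h) - (1 + c * (w * h)\<^sup>2)\<bar> \<le> B1 * (w * h) ^ 4 \<and>
      \<bar>\<bar>c\<bar> * ((w * h)\<^sup>2 * (\<phi> (w * h) * (\<phi> (w * h) * \<phi> (w * h)))) - \<bar>c\<bar> * (w * h)\<^sup>2\<bar> \<le> B2 * (w * h) ^ 4 \<and>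
      \<phi> (w * h) > 1 / 2"
    then have om: "om w h = w * \<phi> t" and b1: "\<bar>\<phi> t - (1 + c * t\<^sup>2)\<bar> \<le> B1 * t ^ 4"
      and b2: "\<bar>\<bar>c\<bar> * (t\<^sup>2 * (\<phi> t * (\<phi> t * \<phi> t))) - \<bar>c\<bar> * t\<^sup>2\<bar> \<le> B2 * t ^ 4"
      and half: "\<phi> t > 1 / 2"
      by (simp_all add: t_def)
    have "\<bar>w - om w h\<bar> = w * \<bar>1 - \<phi> t\<bar>"
      using \<open>w > 0\<close> om abs_mult[of w "1 - \<phi> t"] by (simp add: algebra_simps)
    then have lhs: "\<bar>w - om w h\<bar> - \<bar>c\<bar> * om w h ^ 3 * h\<^sup>2 =
        w * (\<bar>1 - \<phi> t\<bar> - \<bar>c\<bar> * (t\<^sup>2 * (\<phi> t * (\<phi> t * \<phi> t))))"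
      by (simp add: om t_def power2_eq_square power3_eq_cube algebra_simps)
    have rhs: "om w h ^ 5 * h ^ 4 = w * (t ^ 4 * \<phi> t ^ 5)"
      unfolding om t_def by algebra
    have ct: "\<bar>c * t\<^sup>2\<bar> = \<bar>c\<bar> * t\<^sup>2"
      by (simp add: abs_mult)
    \<comment> \<open>Reverse triangle inequality: |1 - \<phi>| and |c| t^2 differ by at most
      |\<phi> - (1 + c t^2)|; \<open>B2\<close> then accounts for the cube of \<phi>.\<close>
    have "\<bar>\<bar>1 - \<phi> t\<bar> - \<bar>c\<bar> * (t\<^sup>2 * (\<phi> t * (\<phi> t * \<phi> t)))\<bar> \<le> (B1 + B2) * t ^ 4"
      using b1 b2 ct unfolding distrib_right by linarith
    also have "\<dots> \<le> \<bar>B1 + B2\<bar> * t ^ 4 * (32 * \<phi> t ^ 5)"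
    proof -
      have "(1 / 2) ^ 5 \<le> \<phi> t ^ 5"
        using half by (intro power_mono) auto
      then have "1 \<le> 32 * \<phi> t ^ 5" by (simp add: power_divide)
      then have "\<bar>B1 + B2\<bar> * t ^ 4 * 1 \<le> \<bar>B1 + B2\<bar> * t ^ 4 * (32 * \<phi> t ^ 5)"
        by (intro mult_left_mono) auto
      moreover have "(B1 + B2) * t ^ 4 \<le> \<bar>B1 + B2\<bar> * t ^ 4"
        by (intro mult_right_mono) auto
      ultimately show ?thesis by simp
    qed
    finally have "w * \<bar>\<bar>1 - \<phi> t\<bar> - \<bar>c\<bar> * (t\<^sup>2 * (\<phi> t * (\<phi> t * \<phi> t)))\<bar>
        \<le> w * (\<bar>B1 + B2\<bar> * t ^ 4 * (32 * \<phi> t ^ 5))"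
      using \<open>w > 0\<close> by simp
    moreover have "\<bar>\<bar>w - om w h\<bar> - \<bar>c\<bar> * om w h ^ 3 * h\<^sup>2\<bar> =
        w * \<bar>\<bar>1 - \<phi> t\<bar> - \<bar>c\<bar> * (t\<^sup>2 * (\<phi> t * (\<phi> t * \<phi> t)))\<bar>"
      unfolding lhs abs_mult using \<open>w > 0\<close> by simp
    moreover have "\<bar>om w h ^ 5 * h ^ 4\<bar> = w * (t ^ 4 * \<phi> t ^ 5)"
      unfolding rhs using \<open>w > 0\<close> half by (intro abs_of_nonneg) auto
    ultimately show "norm (case (w, h) of (w, h) \<Rightarrow> \<bar>w - om w h\<bar> - \<bar>c\<bar> * om w h ^ 3 * h\<^sup>2)
      \<le> (32 * \<bar>B1 + B2\<bar>) * norm (case (w, h) of (w, h) \<Rightarrow> om w h ^ 5 * h ^ 4)"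
      by (simp only: case_prod_conv real_norm_def) (simp only: mult_ac)
  qed
  then show ?thesis by (rule bigoI)
qed


section \<open>Angle identities and scaling shared by the three schemes\<close>

lemma numerical_wave_number_pos:
  assumes "0 < M" and "M < 1"
  shows "1 + M * cos \<theta> > (0::real)"
proof -
  have "M * (- cos \<theta>) \<le> M * 1"
    using assms cos_ge_minus_one[of \<theta>] by (intro mult_left_mono) auto
  then show ?thesis using assms(2) by simp
qed

lemma cos_4x: "cos (4 * x) = 8 * cos x ^ 4 - 8 * (cos x)\<^sup>2 + 1" for x :: real
proof -
  have "cos (4 * x) = 2 * (cos (2 * x))\<^sup>2 - 1"
    using cos_double_cos[of "2 * x"] by simp
  then show ?thesis
    unfolding cos_double_cos by algebra
qed


lemmas jet_intros =
  jet_const jet_square jet_cos jet_sinc jet_versinc jet_add jet_diff jet_mult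

text \<open>Once \<open>t = w * h\<close> is factored out of the linear term and \<open>t^2\<close>
  out of the radicand, \<open>t / h = w\<close> remains. This gives the form required by
  \<open>dispersion_from_jet\<close>.\<close>

lemma quadratic_root_scale:
  fixes w h :: real
  assumes "w > 0" and "h > 0"
  shows "K / h * (w * h * g + sqrt ((w * h * g)\<^sup>2 + (w * h)\<^sup>2 * q)) = w * (K * (g + sqrt (g\<^sup>2 + q)))"
proof -
  have "(w * h * g)\<^sup>2 + (w * h)\<^sup>2 * q = (w * h)\<^sup>2 * (g\<^sup>2 + q)"
    by algebra
  then have "sqrt ((w * h * g)\<^sup>2 + (w * h)\<^sup>2 * q) = w * h * sqrt (g\<^sup>2 + q)"
    using assms by (simp add: real_sqrt_mult)
  then show ?thesis
    using assms by (simp add: field_simps)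
qed

lemma wave_vector_scale:
  "k1h M \<theta> w * h = cos \<theta> / (1 + M * cos \<theta>) * (w * h)"
  "k2h M \<theta> w * h = sin \<theta> / (1 + M * cos \<theta>) * (w * h)"
  by (simp_all add: k1h_def k2h_def kh_def)

section \<open>The three schemes\<close>

lemma RT1_dispersion:
  assumes M: "0 < M" "M < 1"
  shows "(\<lambda>(w, h). \<bar>w - omega_RT1 M \<theta> w h\<bar> - A1 RT1_NC M \<theta> * omega_RT1 M \<theta> w h ^ 3 * h\<^sup>2)
    \<in> O[small_wh](\<lambda>(w, h). omega_RT1 M \<theta> w h ^ 5 * h ^ 4)"
proof -
  define u where "u = 1 / (1 + M * cos \<theta>)"
  have P: "1 + M * cos \<theta> > 0" using numerical_wave_number_pos[OF M] .
  have "u > 0" and u: "u * (1 + M * cos \<theta>) = 1"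
    using P by (simp_all add: u_def)
  have sc: "(sin \<theta>)\<^sup>2 = 1 - (cos \<theta>)\<^sup>2" by (rule sin_squared_eq)
  \<comment> \<open>The factor 1/2 reflects the half arguments of this relation. Below,
    \<open>c\<close> is the signed form of \<open>A1\<close>, with \<open>u^3\<close> in place of
    the cubed denominator.\<close>
  define a b where "a = cos \<theta> * u / 2" and "b = sin \<theta> * u / 2"
  define c where "c = (2 * (1 + cos (4 * \<theta>)) + 4 * M * (cos (3 * \<theta>) - 3 * cos \<theta>)
      + M\<^sup>2 * (cos (4 * \<theta>) - 6 * cos (2 * \<theta>) - 7)) / 384 * u ^ 3"
  define G where "G = (\<lambda>t. a * sinc (a * t) * cos (b * t) * (2 * cos (a * t) + cos (b * t)) /
      ((cos (a * t) + cos (b * t)) * (cos (a * t) * cos (b * t) + 2)))"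
  define Q where "Q = (\<lambda>t. 3 / 2 *
      (((cos (a * t) + cos (b * t)) * (a\<^sup>2 * versinc (a * t) + cos (a * t) * (b\<^sup>2 * versinc (b * t)))
          - M\<^sup>2 * (a\<^sup>2 * (sinc (a * t) * sinc (a * t))) * cos (b * t)) /
        (M\<^sup>2 * (cos (a * t) + cos (b * t)) * (2 + cos (a * t) * cos (b * t)))))"
  \<comment> \<open>\<open>n0\<close> and \<open>n1\<close> are the two coefficients of the
    numerator of \<open>Q\<close>. The denominator is \<open>6 * M^2\<close> times 1 - 5/12 (a^2 +
    b^2) t^2 to this order, whence the 5/12 in the jet of \<open>Q\<close>.\<close>
  define n0 where "n0 = a\<^sup>2 + b\<^sup>2 - M\<^sup>2 * a\<^sup>2"
  define n1 where "n1 = - (a ^ 4 + b ^ 4) / 12 - a\<^sup>2 * b\<^sup>2 / 2 - (a\<^sup>2 + b\<^sup>2)\<^sup>2 / 4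
    + M\<^sup>2 * a\<^sup>2 * (a\<^sup>2 / 3 + b\<^sup>2 / 2)"
  have G: "jet G (a / 2) (- a * (a\<^sup>2 + 3 * b\<^sup>2) / 24)"
    unfolding G_def
    by (rule jet_divide, (rule jet_intros)+) (simp_all add: power2_eq_square field_simps)
  have Q: "jet Q (3 / 2 * (n0 / (6 * M\<^sup>2)))
      (3 / 2 * ((n1 + 5 / 12 * n0 * (a\<^sup>2 + b\<^sup>2)) / (6 * M\<^sup>2)))"
    unfolding Q_def n0_def n1_def
    by (rule jet_cmult, rule jet_divide, (rule jet_intros)+)
      (use M in \<open>simp_all add: power2_eq_square power4_eq_xxxx field_simps\<close>)
  have \<phi>: "jet (\<lambda>t. 4 * M * (G t + sqrt ((G t)\<^sup>2 + Q t))) 1 c"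
  proof (rule jet_quadratic_root[OF G Q])
    \<comment> \<open>This fixes the leading root as \<open>r = u / (4 * M)\<close>. The equation is
      \<open>u * (1 + M * cos \<theta>) = 1\<close> in disguise and expresses consistency of the
      scheme.\<close>
    show "a / 2 + u / (4 * M) = 1 / (4 * M)"
      using M u unfolding a_def by (simp add: field_simps)
    show "(a / 2)\<^sup>2 + 3 / 2 * (n0 / (6 * M\<^sup>2)) = (u / (4 * M))\<^sup>2"
      unfolding n0_def a_def b_def by (use M in \<open>simp add: field_simps\<close>) (use sc in algebra)
    show "2 * (a / 2) * (- a * (a\<^sup>2 + 3 * b\<^sup>2) / 24) +
        3 / 2 * ((n1 + 5 / 12 * n0 * (a\<^sup>2 + b\<^sup>2)) / (6 * M\<^sup>2)) =
      2 * (u / (4 * M)) * (c / (4 * M) - - a * (a\<^sup>2 + 3 * b\<^sup>2) / 24)"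
      unfolding n0_def n1_def a_def b_def c_def cos_treble_cos cos_4x cos_double_cos
      by (use M in \<open>simp add: field_simps\<close>) (use sc in algebra)
  qed (use M \<open>u > 0\<close> in auto)
  have "omega_RT1 M \<theta> w h = w * (4 * M * (G (w * h) + sqrt ((G (w * h))\<^sup>2 + Q (w * h))))"
    if "w > 0" "h > 0" for w h
  proof -
    define t where "t = w * h"
    have ab: "k1h M \<theta> w * h / 2 = a * t" "k2h M \<theta> w * h / 2 = b * t"
      by (simp_all add: wave_vector_scale a_def b_def u_def t_def)
    have S: "sin (a * t) = t * (a * sinc (a * t))"
      by (simp add: sin_eq_sinc)
    \<comment> \<open>Split as (1 - C1) + C1 (1 - C2), so that each summand carries a factor
      t^2.\<close>
    have C: "1 - cos (a * t) * cos (b * t) =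
        t\<^sup>2 * (a\<^sup>2 * versinc (a * t) + cos (a * t) * (b\<^sup>2 * versinc (b * t)))"
      using one_minus_cos_eq_versinc[of "a * t"] one_minus_cos_eq_versinc[of "b * t"]
      by algebra
    have "omega_RT1 M \<theta> w h = 4 * M / h * (t * G t + sqrt ((t * G t)\<^sup>2 + t\<^sup>2 * Q t))"
      unfolding omega_RT1_def Let_def ab S C G_def Q_def
      by (simp add: power_mult_distrib power2_eq_square algebra_simps)
    then show ?thesis
      unfolding t_def quadratic_root_scale[OF that] .
  qed
  then have "\<forall>\<^sub>F t in at_right 0. \<forall>w > 0. \<forall>h > 0. w * h = t \<longrightarrow>
      omega_RT1 M \<theta> w h = w * (4 * M * (G t + sqrt ((G t)\<^sup>2 + Q t)))"
    by simp
  moreover have "A1 RT1_NC M \<theta> = \<bar>c\<bar>"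
    using P by (simp add: c_def u_def abs_mult power_divide)
  ultimately show ?thesis
    using dispersion_from_jet[OF \<phi>, of "omega_RT1 M \<theta>"] by simp
qed

section \<open>The P1-C scheme\<close>

lemma P1_dispersion:
  assumes M: "0 < M" "M < 1"
  shows "(\<lambda>(w, h). \<bar>w - omega_P1 M \<theta> w h\<bar> - A1 P1_C M \<theta> * omega_P1 M \<theta> w h ^ 3 * h\<^sup>2)
    \<in> O[small_wh](\<lambda>(w, h). omega_P1 M \<theta> w h ^ 5 * h ^ 4)"
proof -
  define u where "u = 1 / (1 + M * cos \<theta>)"
  have P: "1 + M * cos \<theta> > 0" using numerical_wave_number_pos[OF M] .
  have "u > 0" and u: "u * (1 + M * cos \<theta>) = 1"
    using P by (simp_all add: u_def)
  have sc: "(sin \<theta>)\<^sup>2 = 1 - (cos \<theta>)\<^sup>2" by (rule sin_squared_eq)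
  define a b where "a = cos \<theta> * u" and "b = sin \<theta> * u"
  define c where "c = (3 + cos (4 * \<theta>) - 4 * M\<^sup>2 * cos \<theta> ^ 4) / 96 * u ^ 3"
  define D where "D = (\<lambda>t. cos (a * t) * cos (b * t) + 2 * (cos (a * t) + cos (b * t)) + 4)"
  define G where "G = (\<lambda>t. a * sinc (a * t) * (2 + cos (b * t)) / D t)"
  define Q where "Q = (\<lambda>t. 2 / 3 *
      ((3 * (a\<^sup>2 * versinc (a * t)) + 3 * (b\<^sup>2 * versinc (b * t))
          - 2 * (t\<^sup>2 * (a\<^sup>2 * versinc (a * t) * (b\<^sup>2 * versinc (b * t))))
          - M\<^sup>2 * (3 * (a\<^sup>2 * versinc (a * t))
              - t\<^sup>2 * (a\<^sup>2 * versinc (a * t) * (b\<^sup>2 * versinc (b * t))))) /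
        (M\<^sup>2 * D t)))"
  define n0 where "n0 = 3 / 2 * (a\<^sup>2 + b\<^sup>2 - M\<^sup>2 * a\<^sup>2)"
  define n1 where "n1 = - (a ^ 4 + b ^ 4) / 8 - a\<^sup>2 * b\<^sup>2 / 2 + M\<^sup>2 * (a ^ 4 / 8 + a\<^sup>2 * b\<^sup>2 / 4)"
  \<comment> \<open>Numerator and denominator have the same relative t^2 coefficient -(a^2 + b^2) /
    6, so the correction cancels.\<close>
  have G: "jet G (a / 3) 0"
    unfolding G_def D_def
    by (rule jet_divide, (rule jet_intros)+) (simp_all add: power2_eq_square field_simps)
  have Q: "jet Q (2 / 3 * (n0 / (9 * M\<^sup>2)))
      (2 / 3 * ((n1 + n0 * (a\<^sup>2 + b\<^sup>2) / 6) / (9 * M\<^sup>2)))"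
    unfolding Q_def D_def n0_def n1_def
    by (rule jet_cmult, rule jet_divide, (rule jet_intros)+)
      (use M in \<open>simp_all add: power2_eq_square power4_eq_xxxx field_simps\<close>)
  have \<phi>: "jet (\<lambda>t. 3 * M * (G t + sqrt ((G t)\<^sup>2 + Q t))) 1 c"
  proof (rule jet_quadratic_root[OF G Q])
    show "a / 3 + u / (3 * M) = 1 / (3 * M)"
      using M u unfolding a_def by (simp add: field_simps)
    show "(a / 3)\<^sup>2 + 2 / 3 * (n0 / (9 * M\<^sup>2)) = (u / (3 * M))\<^sup>2"
      unfolding n0_def a_def b_def by (use M in \<open>simp add: field_simps\<close>) (use sc in algebra)
    show "2 * (a / 3) * 0 + 2 / 3 * ((n1 + n0 * (a\<^sup>2 + b\<^sup>2) / 6) / (9 * M\<^sup>2)) =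
      2 * (u / (3 * M)) * (c / (3 * M) - 0)"
      unfolding n0_def n1_def a_def b_def c_def cos_4x
      by (use M in \<open>simp add: field_simps\<close>) (use sc in algebra)
  qed (use M \<open>u > 0\<close> in auto)
  have "omega_P1 M \<theta> w h = w * (3 * M * (G (w * h) + sqrt ((G (w * h))\<^sup>2 + Q (w * h))))"
    if "w > 0" "h > 0" for w h
  proof -
    define t where "t = w * h"
    have ab: "k1h M \<theta> w * h = a * t" "k2h M \<theta> w * h = b * t"
      by (simp_all add: wave_vector_scale a_def b_def u_def t_def)
    have G: "sin (a * t) * (2 + cos (b * t)) / D t = t * G t"
      by (simp add: G_def sin_eq_sinc)
    \<comment> \<open>Rewriting in X = 1 - C1 and Y = 1 - C2 gives -(3X + 3Y - 2XY - M^2 (3X - XY)).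
      The outer sign cancels the minus under the root of the relation.\<close>
    have "2 * cos (a * t) * cos (b * t) + cos (a * t) + cos (b * t) - 4
        + M\<^sup>2 * (2 - cos (a * t) * cos (b * t) - 2 * cos (a * t) + cos (b * t)) =
      - (t\<^sup>2 * (3 * (a\<^sup>2 * versinc (a * t)) + 3 * (b\<^sup>2 * versinc (b * t))
          - 2 * (t\<^sup>2 * (a\<^sup>2 * versinc (a * t) * (b\<^sup>2 * versinc (b * t))))
          - M\<^sup>2 * (3 * (a\<^sup>2 * versinc (a * t))
              - t\<^sup>2 * (a\<^sup>2 * versinc (a * t) * (b\<^sup>2 * versinc (b * t))))))"
      using one_minus_cos_eq_versinc[of "a * t"] one_minus_cos_eq_versinc[of "b * t"]
      by algebra
    then have Q: "2 / 3 * ((2 * cos (a * t) * cos (b * t) + cos (a * t) + cos (b * t) - 4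
        + M\<^sup>2 * (2 - cos (a * t) * cos (b * t) - 2 * cos (a * t) + cos (b * t))) / (M\<^sup>2 * D t)) =
      - (t\<^sup>2 * Q t)"
      by (simp add: Q_def)
    have "omega_P1 M \<theta> w h = 3 * M / h * (t * G t + sqrt ((t * G t)\<^sup>2 + t\<^sup>2 * Q t))"
      unfolding omega_P1_def Let_def ab D_def[symmetric, THEN fun_cong] G Q by simp
    then show ?thesis
      unfolding t_def quadratic_root_scale[OF that] .
  qed
  then have "\<forall>\<^sub>F t in at_right 0. \<forall>w > 0. \<forall>h > 0. w * h = t \<longrightarrow>
      omega_P1 M \<theta> w h = w * (3 * M * (G t + sqrt ((G t)\<^sup>2 + Q t)))"
    by simp
  moreover have "A1 P1_C M \<theta> = \<bar>c\<bar>"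
    using P by (simp add: c_def u_def abs_mult power_divide)
  ultimately show ?thesis
    using dispersion_from_jet[OF \<phi>, of "omega_P1 M \<theta>"] by simp
qed

section \<open>The RT2-NC scheme and its removable singularities in the angle\<close>

text \<open>
  Cancelling the common factor \<open>k1 k2 h\<close> from the quotients of \<open>RT2_NC\<close> leaves expressions that
  are continuous in \<open>\<theta>\<close>, so their values are the limits taken by \<open>RT2_ext\<close>.
\<close>

definition RT2_G_reg :: "real \<Rightarrow> real \<Rightarrow> real" where
  "RT2_G_reg x y = x * (sinc x * sinc y + versinc x * (1 + cos y)) /
    (sinc y * (5 + cos x) + sinc x * (5 + cos y))"

definition RT2_root_reg :: "real \<Rightarrow> real \<Rightarrow> real \<Rightarrow> real" where
  "RT2_root_reg M x y =
    (x\<^sup>2 * (versinc x * sinc y) + y\<^sup>2 * (versinc y * sinc x) - M\<^sup>2 * (x\<^sup>2 * (versinc x * sinc y))) /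
    (M\<^sup>2 * (sinc y * (5 + cos x) + sinc x * (5 + cos y)))"

lemma RT2_quotients_eq_reg:
  assumes "h > 0" and "k1h M \<theta> w \<noteq> 0" and "k2h M \<theta> w \<noteq> 0"
  shows "RT2_G_quotient M w h \<theta> = RT2_G_reg (k1h M \<theta> w * h) (k2h M \<theta> w * h)"
    and "RT2_root_quotient M w h \<theta> = RT2_root_reg M (k1h M \<theta> w * h) (k2h M \<theta> w * h)"
proof -
  define x y where "x = k1h M \<theta> w" and "y = k2h M \<theta> w"
  define C1 C2 where "C1 = cos (x * h)" and "C2 = cos (y * h)"
  define D where "D = sinc (y * h) * (5 + C1) + sinc (x * h) * (5 + C2)"
  have S: "sin (x * h) = x * h * sinc (x * h)" "sin (y * h) = y * h * sinc (y * h)"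
    by (rule sin_eq_sinc)+
  have C: "1 - C1 = (x * h)\<^sup>2 * versinc (x * h)" "1 - C2 = (y * h)\<^sup>2 * versinc (y * h)"
    unfolding C1_def C2_def by (rule one_minus_cos_eq_versinc)+
  have nz: "x * y * h \<noteq> 0" using assms by (simp add: x_def y_def)
  have D: "x * sin (y * h) * (5 + C1) + y * sin (x * h) * (5 + C2) = x * y * h * D"
    unfolding S D_def by algebra
  have G: "x * sin (x * h) * sin (y * h) + y * (1 - C1) * (1 + C2) =
      x * y * h * (x * h * (sinc (x * h) * sinc (y * h) + versinc (x * h) * (1 + C2)))"
    unfolding S C by algebra
  have Q: "x * sin (y * h) * (1 - C1) + y * sin (x * h) * (1 - C2) - M\<^sup>2 * x * sin (y * h) * (1 - C1) =
      x * y * h * ((x * h)\<^sup>2 * (versinc (x * h) * sinc (y * h)) + (y * h)\<^sup>2 * (versinc (y * h) * sinc (x * h))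
        - M\<^sup>2 * ((x * h)\<^sup>2 * (versinc (x * h) * sinc (y * h))))"
    unfolding S C by algebra
  show "RT2_G_quotient M w h \<theta> = RT2_G_reg (k1h M \<theta> w * h) (k2h M \<theta> w * h)"
    unfolding RT2_G_quotient_def RT2_G_reg_def Let_def x_def[symmetric] y_def[symmetric]
      C1_def[symmetric] C2_def[symmetric] D G D_def[symmetric]
    by (rule mult_divide_mult_cancel_left[OF nz])
  have "M\<^sup>2 * (x * y * h * D) = x * y * h * (M\<^sup>2 * D)"
    by simp
  then show "RT2_root_quotient M w h \<theta> = RT2_root_reg M (k1h M \<theta> w * h) (k2h M \<theta> w * h)"
    unfolding RT2_root_quotient_def RT2_root_reg_def Let_def x_def[symmetric] y_def[symmetric]
      C1_def[symmetric] C2_def[symmetric] D Q D_def[symmetric]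
    by (simp only: mult_divide_mult_cancel_left[OF nz])
qed

text \<open>On [0, pi] a component vanishes only at 0, pi/2 and pi, and a punctured neighbourhood of
  \<open>\<theta>\<close> avoids these three points.\<close>

lemma eventually_wave_vector_nonzero:
  assumes M: "0 < M" "M < 1" and "w > 0"
  shows "\<forall>\<^sub>F \<phi> in at \<theta> within {0..pi}. k1h M \<phi> w \<noteq> 0 \<and> k2h M \<phi> w \<noteq> 0"
proof -
  have "\<forall>\<^sub>F \<phi> in at \<theta> within {0..pi}. \<phi> \<in> {0..pi}"
    by (simp add: eventually_at_filter)
  moreover note eventually_neq_at_within[of 0 \<theta> "{0..pi}"]
    eventually_neq_at_within[of pi \<theta> "{0..pi}"] eventually_neq_at_within[of "pi / 2" \<theta> "{0..pi}"]
  ultimately show ?thesis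
  proof eventually_elim
    case (elim \<phi>)
    have "sin \<phi> > 0"
      using elim by (intro sin_gt_zero) auto
    moreover have "cos \<phi> \<noteq> cos (pi / 2)"
      using elim cos_inj_pi[of \<phi> "pi / 2"] by auto
    ultimately show ?case
      using numerical_wave_number_pos[OF M, of \<phi>] \<open>w > 0\<close>
      by (simp add: k1h_def k2h_def kh_def)
  qed
qed

text \<open>At a degenerate angle, \<open>q\<close> agrees with the continuous \<open>g\<close> on a
  punctured neighbourhood and so has limit \<open>g \<theta>\<close>; the limit is unique because
  [0, pi] has no isolated points. At any other angle the two agree directly.\<close>

lemma RT2_ext_eq:
  assumes M: "0 < M" "M < 1" and "w > 0" and "\<theta> \<in> {0..pi}"
    and eq: "\<And>\<phi>. k1h M \<phi> w \<noteq> 0 \<Longrightarrow> k2h M \<phi> w \<noteq> 0 \<Longrightarrow> q M w h \<phi> = g \<phi>"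
    and cont: "isCont g \<theta>"
  shows "RT2_ext q M w h \<theta> = g \<theta>"
proof -
  have "(g \<longlongrightarrow> g \<theta>) (at \<theta> within {0..pi})"
    using cont unfolding isCont_def by (rule tendsto_within_subset) simp
  then have "(q M w h \<longlongrightarrow> g \<theta>) (at \<theta> within {0..pi})"
    by (rule Lim_transform_eventually)
      (use eventually_wave_vector_nonzero[OF M \<open>w > 0\<close>] in \<open>eventually_elim, simp add: eq\<close>)
  moreover have "at \<theta> within {0..pi} \<noteq> bot"
    using \<open>\<theta> \<in> {0..pi}\<close> by (simp add: trivial_limit_within islimpt_Icc)
  ultimately have "Lim (at \<theta> within {0..pi}) (q M w h) = g \<theta>"
    by (intro tendsto_Lim)
  then show ?thesis by (simp add: RT2_ext_def eq)
qed

lemma isCont_versinc: "isCont versinc x"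
  unfolding versinc_def
  by (intro continuous_intros isCont_o2[OF _ isCont_sinc]) auto

lemma isCont_wave_vector:
  assumes "0 < M" "M < 1"
  shows "isCont (\<lambda>\<phi>. k1h M \<phi> w) \<theta>" and "isCont (\<lambda>\<phi>. k2h M \<phi> w) \<theta>"
  unfolding k1h_def k2h_def kh_def
  using numerical_wave_number_pos[OF assms, of \<theta>] by (intro continuous_intros; simp)+

text \<open>The condition \<open>nz\<close> says that the regularized denominator does not vanish,
  which gives continuity at \<open>\<theta>\<close>. It holds for small \<open>w * h\<close>, where
  this denominator is close to 12.\<close>

lemma RT2_ext_quotients:
  assumes M: "0 < M" "M < 1" and "w > 0" and "h > 0" and "\<theta> \<in> {0..pi}"
    and nz: "sinc (k2h M \<theta> w * h) * (5 + cos (k1h M \<theta> w * h))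
      + sinc (k1h M \<theta> w * h) * (5 + cos (k2h M \<theta> w * h)) \<noteq> 0"
  shows "RT2_ext RT2_G_quotient M w h \<theta> = RT2_G_reg (k1h M \<theta> w * h) (k2h M \<theta> w * h)"
    and "RT2_ext RT2_root_quotient M w h \<theta> = RT2_root_reg M (k1h M \<theta> w * h) (k2h M \<theta> w * h)"
proof -
  note wave = isCont_wave_vector[OF M, where w = w and \<theta> = \<theta>]
  note wave_h = wave[THEN isCont_mult[OF _ continuous_const], of h]
  note cont = wave isCont_o2[OF wave_h(1) isCont_sinc] isCont_o2[OF wave_h(2) isCont_sinc]
    isCont_o2[OF wave_h(1) isCont_versinc] isCont_o2[OF wave_h(2) isCont_versinc]
  have cont_G: "isCont (\<lambda>\<phi>. RT2_G_reg (k1h M \<phi> w * h) (k2h M \<phi> w * h)) \<theta>"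
    unfolding RT2_G_reg_def by (intro continuous_intros cont nz)
  show "RT2_ext RT2_G_quotient M w h \<theta> = RT2_G_reg (k1h M \<theta> w * h) (k2h M \<theta> w * h)"
    by (rule RT2_ext_eq[OF M \<open>w > 0\<close> \<open>\<theta> \<in> {0..pi}\<close> _ cont_G])
      (rule RT2_quotients_eq_reg(1)[OF \<open>h > 0\<close>])
  have cont_root: "isCont (\<lambda>\<phi>. RT2_root_reg M (k1h M \<phi> w * h) (k2h M \<phi> w * h)) \<theta>"
    unfolding RT2_root_reg_def by (intro continuous_intros cont) (use M nz in auto)
  show "RT2_ext RT2_root_quotient M w h \<theta> = RT2_root_reg M (k1h M \<theta> w * h) (k2h M \<theta> w * h)"
    by (rule RT2_ext_eq[OF M \<open>w > 0\<close> \<open>\<theta> \<in> {0..pi}\<close> _ cont_root])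
      (rule RT2_quotients_eq_reg(2)[OF \<open>h > 0\<close>])
qed

lemma RT2_dispersion:
  assumes M: "0 < M" "M < 1" and \<theta>: "\<theta> \<in> {0..pi}"
  shows "(\<lambda>(w, h). \<bar>w - omega_RT2 M \<theta> w h\<bar> - A1 RT2_NC M \<theta> * omega_RT2 M \<theta> w h ^ 3 * h\<^sup>2)
    \<in> O[small_wh](\<lambda>(w, h). omega_RT2 M \<theta> w h ^ 5 * h ^ 4)"
proof -
  define u where "u = 1 / (1 + M * cos \<theta>)"
  have P: "1 + M * cos \<theta> > 0" using numerical_wave_number_pos[OF M] .
  have "u > 0" and u: "u * (1 + M * cos \<theta>) = 1"
    using P by (simp_all add: u_def)
  have sc: "(sin \<theta>)\<^sup>2 = 1 - (cos \<theta>)\<^sup>2" by (rule sin_squared_eq)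
  define a b where "a = cos \<theta> * u" and "b = sin \<theta> * u"
  define c where "c = (2 * (1 + cos (4 * \<theta>)) + 4 * M * (cos (3 * \<theta>) - cos \<theta>)
      + M\<^sup>2 * (cos (4 * \<theta>) - 2 * cos (2 * \<theta>) - 3)) / 192 * u ^ 3"
  define D where "D = (\<lambda>t. sinc (b * t) * (5 + cos (a * t)) + sinc (a * t) * (5 + cos (b * t)))"
  define G where "G = (\<lambda>t. a * (sinc (a * t) * sinc (b * t) + versinc (a * t) * (1 + cos (b * t))) / D t)"
  define Q where "Q = (\<lambda>t. 2 / 3 *
      ((a\<^sup>2 * (versinc (a * t) * sinc (b * t)) + b\<^sup>2 * (versinc (b * t) * sinc (a * t))
          - M\<^sup>2 * (a\<^sup>2 * (versinc (a * t) * sinc (b * t)))) /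
        (M\<^sup>2 * D t)))"
  define n0 where "n0 = (a\<^sup>2 + b\<^sup>2 - M\<^sup>2 * a\<^sup>2) / 2"
  define n1 where "n1 = (1 - M\<^sup>2) * a\<^sup>2 * (- a\<^sup>2 / 24 - b\<^sup>2 / 12) + b\<^sup>2 * (- b\<^sup>2 / 24 - a\<^sup>2 / 12)"
  have D: "jet D 12 (- 3 / 2 * (a\<^sup>2 + b\<^sup>2))"
    unfolding D_def by (rule jet_eq, (rule jet_intros)+) (simp_all add: field_simps)
  have G: "jet G (a / 6) (- a * b\<^sup>2 / 72)"
    unfolding G_def
    by (rule jet_divide[OF _ D], (rule jet_intros)+) (simp_all add: power2_eq_square field_simps)
  have Q: "jet Q (2 / 3 * (n0 / (12 * M\<^sup>2)))
      (2 / 3 * ((n1 + n0 * (a\<^sup>2 + b\<^sup>2) / 8) / (12 * M\<^sup>2)))"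
    unfolding Q_def n0_def n1_def
    by (rule jet_cmult, rule jet_divide[OF _ jet_cmult[OF D]], (rule jet_intros)+)
      (use M in \<open>simp_all add: power2_eq_square power4_eq_xxxx field_simps\<close>)
  have \<phi>: "jet (\<lambda>t. 6 * M * (G t + sqrt ((G t)\<^sup>2 + Q t))) 1 c"
  proof (rule jet_quadratic_root[OF G Q])
    show "a / 6 + u / (6 * M) = 1 / (6 * M)"
      using M u unfolding a_def by (simp add: field_simps)
    show "(a / 6)\<^sup>2 + 2 / 3 * (n0 / (12 * M\<^sup>2)) = (u / (6 * M))\<^sup>2"
      unfolding n0_def a_def b_def by (use M in \<open>simp add: field_simps\<close>) (use sc in algebra)
    show "2 * (a / 6) * (- a * b\<^sup>2 / 72) +
        2 / 3 * ((n1 + n0 * (a\<^sup>2 + b\<^sup>2) / 8) / (12 * M\<^sup>2)) =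
      2 * (u / (6 * M)) * (c / (6 * M) - - a * b\<^sup>2 / 72)"
      unfolding n0_def n1_def a_def b_def c_def cos_treble_cos cos_4x cos_double_cos
      by (use M in \<open>simp add: field_simps\<close>) (use sc in algebra)
  qed (use M \<open>u > 0\<close> in auto)
  \<comment> \<open>The limits in the angle are identified only where \<open>D t\<close> is nonzero,
    so the scaling identity is obtained just for small \<open>t\<close>, while for the other two
    schemes it holds for all positive \<open>w\<close> and \<open>h\<close>.\<close>
  have "\<forall>\<^sub>F t in at_right 0. D t \<noteq> 0"
    by (rule tendsto_imp_eventually_ne[OF jet_tendsto[OF D]]) simp
  then have "\<forall>\<^sub>F t in at_right 0. \<forall>w > 0. \<forall>h > 0. w * h = t \<longrightarrow>
      omega_RT2 M \<theta> w h = w * (6 * M * (G t + sqrt ((G t)\<^sup>2 + Q t)))"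
  proof (eventually_elim, intro allI impI)
    fix t w h :: real
    assume "D t \<noteq> 0" and wh: "w > 0" "h > 0" and t: "w * h = t"
    have ab: "k1h M \<theta> w * h = a * t" "k2h M \<theta> w * h = b * t"
      by (simp_all add: wave_vector_scale a_def b_def u_def t)
    from \<open>D t \<noteq> 0\<close> have nz: "sinc (k2h M \<theta> w * h) * (5 + cos (k1h M \<theta> w * h))
      + sinc (k1h M \<theta> w * h) * (5 + cos (k2h M \<theta> w * h)) \<noteq> 0"
      by (simp add: D_def ab)
    have G: "RT2_G_reg (a * t) (b * t) = t * G t"
      by (simp add: RT2_G_reg_def G_def D_def)
    have Q: "2 / 3 * RT2_root_reg M (a * t) (b * t) = t\<^sup>2 * Q t"
    proof -
      have "(a * t)\<^sup>2 * (versinc (a * t) * sinc (b * t)) + (b * t)\<^sup>2 * (versinc (b * t) * sinc (a * t))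
          - M\<^sup>2 * ((a * t)\<^sup>2 * (versinc (a * t) * sinc (b * t))) =
        t\<^sup>2 * (a\<^sup>2 * (versinc (a * t) * sinc (b * t)) + b\<^sup>2 * (versinc (b * t) * sinc (a * t))
          - M\<^sup>2 * (a\<^sup>2 * (versinc (a * t) * sinc (b * t))))"
        by algebra
      then show ?thesis
        by (simp add: RT2_root_reg_def Q_def D_def)
    qed
    have "omega_RT2 M \<theta> w h = 6 * M / h * (t * G t + sqrt ((t * G t)\<^sup>2 + t\<^sup>2 * Q t))"
      unfolding omega_RT2_def Let_def RT2_ext_quotients[OF M wh \<theta> nz] ab G Q ..
    then show "omega_RT2 M \<theta> w h = w * (6 * M * (G t + sqrt ((G t)\<^sup>2 + Q t)))"
      unfolding t[symmetric] quadratic_root_scale[OF wh] .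
  qed
  moreover have "A1 RT2_NC M \<theta> = \<bar>c\<bar>"
    using P by (simp add: c_def u_def abs_mult power_divide)
  ultimately show ?thesis
    using dispersion_from_jet[OF \<phi>, of "omega_RT2 M \<theta>"] by simp
qed

theorem theorem3p1:
  fixes M \<theta> :: real and s :: scheme
  assumes "0 < M" and "M < 1" and "\<theta> \<in> {0..pi}"
  shows "(\<lambda>(w, h). dispersion_error s M \<theta> w h - A1 s M \<theta> * (omega s M \<theta> w h) ^ 3 * h\<^sup>2)
           \<in> O[small_wh](\<lambda>(w, h). (omega s M \<theta> w h) ^ 5 * h ^ 4)"
  using RT1_dispersion[OF assms(1,2), of \<theta>] RT2_dispersion[OF assms] P1_dispersion[OF assms(1,2), of \<theta>]
  by (cases s) (simp_all only: dispersion_error_def omega.simps)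

end
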